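(* Let $k\ge1$, let $P\subset\mathbb{R}^k$ be a Pareto set and let $f_P:P\to\mathbb{R}$ be a function. Then $f_P$ can be strictly monotonically extended to $\mathbb{R}^k$ if and only if $f_P$ is upper-bounded on lower sets and lower-bounded on upper sets. Moreover, for such a function $f_P$, every $\alpha,\beta\in\mathbb{R}$ and every strictly increasing function $u:\mathbb{R}^k\to\mathbb{R}$ satisfying $\alpha<u(\mathbf{x})<\beta$ for all $\mathbf{x}\in\mathbb{R}^k$, the function $$f(\mathbf{x})=\begin{cases} f_P(\mathbf{x}), & \mathbf{x}\in P,\\ \min\{b(\mathbf{x}),\beta\}-(\beta-u(\mathbf{x})), & \mathbf{x}\in L,\\ \max\{a(\mathbf{x}),\alpha\}+u(\mathbf{x})-\alpha, & \mathbf{x}\in U,\\ u(\mathbf{x}), & \mathbf{x}\in N,\end{cases}$$ provides a monotone extension of $f_P$ to $\mathbb{R}^k$.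
   Context: For $\mathbf{x},\mathbf{y}\in\mathbb{R}^k$: $\mathbf{x}\ge\mathbf{y}$ means $x_i\ge y_i$ for all $i\in\{1,\dots,k\}$; $\mathbf{x}>\mathbf{y}$ means $\mathbf{x}\ge\mathbf{y}$ and $\mathbf{x}\ne\mathbf{y}$; $\le$ and $<$ are the reverse relations. A set $P\subset\mathbb{R}^k$ is a Pareto set if there are no $\mathbf{x},\mathbf{x}'\in P$ with $\mathbf{x}'>\mathbf{x}$. A real-valued function $g$ on $Q\subseteq\mathbb{R}^k$ is strictly increasing if for all $\mathbf{x},\mathbf{y}\in Q$, $\mathbf{x}>\mathbf{y}$ implies $g(\mathbf{x})>g(\mathbf{y})$. A monotone extension of $f_P$ to $\mathbb{R}^k$ is a strictly increasing $f:\mathbb{R}^k\to\mathbb{R}$ whose restriction to $P$ is $f_P$; $f_P$ can be strictly monotonically extended to $\mathbb{R}^k$ if such an $f$ exists. A subset $P'\subseteq P$ is an upper set if $P'=\{\mathbf{x}\in P\mid\mathbf{x}\ge\mathbf{c}\}$ for some $\mathbf{c}\in\mathbb{R}^k$, and a lower set if $P'=\{\mathbf{x}\in P\mid\mathbf{x}\le\mathbf{c}\}$ for some $\mathbf{c}\in\mathbb{R}^k$. "Upper-bounded on lower sets" means that $f_P$ is bounded above on each lower set; "lower-bounded on upper sets" means that $f_P$ is bounded below on each upper set. With extended real values, $\sup\emptyset=-\infty$ and $\inf\emptyset=+\infty$, define for $\mathbf{x}\in\mathbb{R}^k$ $$a(\mathbf{x})=\sup\{f_P(\mathbf{y})\mid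 \mathbf{y}\le\mathbf{x},\ \mathbf{y}\in P\},\qquad b(\mathbf{x})=\inf\{f_P(\mathbf{z})\mid \mathbf{z}\ge\mathbf{x},\ \mathbf{z}\in P\}.$$ The regions are: $L$ = set of $\mathbf{x}\in\mathbb{R}^k\setminus P$ such that no $\mathbf{y}\in P$ has $\mathbf{y}<\mathbf{x}$ and some $\mathbf{z}\in P$ has $\mathbf{x}<\mathbf{z}$; $U$ = set of $\mathbf{x}\in\mathbb{R}^k\setminus P$ such that some $\mathbf{y}\in P$ has $\mathbf{y}<\mathbf{x}$ and no $\mathbf{z}\in P$ has $\mathbf{x}<\mathbf{z}$; $N$ = set of $\mathbf{x}\in\mathbb{R}^k\setminus P$ such that no $\mathbf{y}\in P$ has $\mathbf{y}<\mathbf{x}$ and no $\mathbf{z}\in P$ has $\mathbf{x}<\mathbf{z}$. Since $P$ is a Pareto set, $\mathbb{R}^k$ is the disjoint union of $P,L,U,N$. *)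

theory Defs
  imports "HOL-Analysis.Analysis"
begin

text \<open>
  Vectors are elements of \<^typ>\<open>real ^ 'n\<close> with \<open>'n\<close> an arbitrary (nonempty) finite type, so the
  dimension is any \<open>k \<ge> 1\<close>. The library order on this type is the componentwise one, and its strict
  part \<open>x < y\<close> means \<open>x \<le> y\<close> and \<open>x \<noteq> y\<close>. A function on \<open>P\<close> is given by a total function \<open>fP\<close>
  of which only the values on \<open>P\<close> are used.
\<close>

lemma vec_less_iff: "x < y \<longleftrightarrow> (\<forall>i. x $ i \<le> y $ i) \<and> x \<noteq> y" for x y :: "real ^ 'n"
  by (auto simp: less_le less_eq_vec_def)

definition pareto_set :: "(real ^ 'n) set \<Rightarrow> bool" where
  "pareto_set P \<longleftrightarrow> \<not> (\<exists>x\<in>P. \<exists>x'\<in>P. x' > x)"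

definition monotone_extension ::
    "(real ^ 'n) set \<Rightarrow> (real ^ 'n \<Rightarrow> real) \<Rightarrow> (real ^ 'n \<Rightarrow> real) \<Rightarrow> bool" where
  "monotone_extension P fP f \<longleftrightarrow> strict_mono f \<and> (\<forall>x\<in>P. f x = fP x)"

definition strictly_monotonically_extendable ::
    "(real ^ 'n) set \<Rightarrow> (real ^ 'n \<Rightarrow> real) \<Rightarrow> bool" where
  "strictly_monotonically_extendable P fP \<longleftrightarrow> (\<exists>f. monotone_extension P fP f)"

definition upper_set :: "(real ^ 'n) set \<Rightarrow> (real ^ 'n) set \<Rightarrow> bool" where
  "upper_set P P' \<longleftrightarrow> (\<exists>c. P' = {x \<in> P. x \<ge> c})"

definition lower_set :: "(real ^ 'n) set \<Rightarrow> (real ^ 'n) set \<Rightarrow> bool" where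
  "lower_set P P' \<longleftrightarrow> (\<exists>c. P' = {x \<in> P. x \<le> c})"

definition upper_bounded_on_lower_sets ::
    "(real ^ 'n) set \<Rightarrow> (real ^ 'n \<Rightarrow> real) \<Rightarrow> bool" where
  "upper_bounded_on_lower_sets P fP \<longleftrightarrow> (\<forall>P'. lower_set P P' \<longrightarrow> bdd_above (fP ` P'))"

definition lower_bounded_on_upper_sets ::
    "(real ^ 'n) set \<Rightarrow> (real ^ 'n \<Rightarrow> real) \<Rightarrow> bool" where
  "lower_bounded_on_upper_sets P fP \<longleftrightarrow> (\<forall>P'. upper_set P P' \<longrightarrow> bdd_below (fP ` P'))"

definition sup_below :: "(real ^ 'n) set \<Rightarrow> (real ^ 'n \<Rightarrow> real) \<Rightarrow> real ^ 'n \<Rightarrow> ereal" where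
  "sup_below P fP x = (SUP y\<in>{y \<in> P. y \<le> x}. ereal (fP y))"

definition inf_above :: "(real ^ 'n) set \<Rightarrow> (real ^ 'n \<Rightarrow> real) \<Rightarrow> real ^ 'n \<Rightarrow> ereal" where
  "inf_above P fP x = (INF z\<in>{z \<in> P. z \<ge> x}. ereal (fP z))"

definition region_L :: "(real ^ 'n) set \<Rightarrow> (real ^ 'n) set" where
  "region_L P = {x \<in> - P. \<not> (\<exists>y\<in>P. y < x) \<and> (\<exists>z\<in>P. x < z)}"

definition region_U :: "(real ^ 'n) set \<Rightarrow> (real ^ 'n) set" where
  "region_U P = {x \<in> - P. (\<exists>y\<in>P. y < x) \<and> \<not> (\<exists>z\<in>P. x < z)}"

definition region_N :: "(real ^ 'n) set \<Rightarrow> (real ^ 'n) set" where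
  "region_N P = {x \<in> - P. \<not> (\<exists>y\<in>P. y < x) \<and> \<not> (\<exists>z\<in>P. x < z)}"

lemma regions_cover:
  assumes "pareto_set P"
  shows "P \<union> region_L P \<union> region_U P \<union> region_N P = UNIV"
  using assms unfolding pareto_set_def region_L_def region_U_def region_N_def
  by (auto dest: less_trans)

lemma regions_disjoint:
  "P \<inter> region_L P = {}" "P \<inter> region_U P = {}" "P \<inter> region_N P = {}"
  "region_L P \<inter> region_U P = {}" "region_L P \<inter> region_N P = {}" "region_U P \<inter> region_N P = {}"
  unfolding region_L_def region_U_def region_N_def by auto

text \<open>
  The extension formula is evaluated in the extended reals, so that its finiteness is not built into
  the definition. For a Pareto set, the last branch is reached exactly on \<open>region_N P\<close>.
\<close>

definition extension_formula ::
    "(real ^ 'n) set \<Rightarrow> (real ^ 'n \<Rightarrow> real) \<Rightarrow> real \<Rightarrow> real \<Rightarrow> (real ^ 'n \<Rightarrow> real) \<Rightarrow> real ^ 'n \<Rightarrow> ereal"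
  where
  "extension_formula P fP \<alpha> \<beta> u x =
    (if x \<in> P then ereal (fP x)
     else if x \<in> region_L P then min (inf_above P fP x) (ereal \<beta>) - (ereal \<beta> - ereal (u x))
     else if x \<in> region_U P then max (sup_below P fP x) (ereal \<alpha>) + ereal (u x) - ereal \<alpha>
     else ereal (u x))"

end

theory Submission
  imports Defs
begin

text \<open>
  The boundedness conditions are necessary because a monotone extension \<open>f\<close> bounds \<open>fP\<close> on the
  lower (upper) set at \<open>c\<close> by its value \<open>f c\<close>.

  For sufficiency, the point is the shape of the formula. On \<open>L\<close>, where only points of \<open>P\<close> above
  \<open>x\<close> constrain the value, the formula lies below \<open>b x\<close> (as \<open>u x < \<beta>\<close>), hence below \<open>fP\<close> at
  every such point, and, thanks to the truncation at \<open>\<beta>\<close>, it is at most \<open>u x\<close>. Dually, on \<open>U\<close> it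
  lies above \<open>a x\<close> and is at least \<open>u x\<close>. On \<open>N\<close> it equals \<open>u x\<close>. So \<open>u\<close> separates the
  regions: whenever \<open>x < y\<close> with \<open>x\<close> and \<open>y\<close> in different regions other than \<open>P\<close>, the point \<open>x\<close> is
  in \<open>L\<close> or \<open>y\<close> is in \<open>U\<close>, and the values are compared through \<open>u x < u y\<close>. Inside \<open>L\<close> or \<open>U\<close> the
  functions \<open>b\<close> and \<open>a\<close> are weakly increasing and the summand \<open>u\<close> makes the formula strictly
  increasing. The boundedness conditions ensure that \<open>b\<close> is finite on \<open>L\<close> and \<open>a\<close> on \<open>U\<close>, so that
  all these comparisons are between real numbers, where adding \<open>u\<close> preserves strictness.

  The equivalence then follows because a strictly increasing bounded \<open>u\<close> exists, namely the
  arctangent of the sum of the coordinates.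
\<close>

lemma bounded_if_strictly_monotonically_extendable:
  assumes "strictly_monotonically_extendable P fP"
  shows "upper_bounded_on_lower_sets P fP" "lower_bounded_on_upper_sets P fP"
proof -
  obtain f where f: "strict_mono f" "\<And>x. x \<in> P \<Longrightarrow> f x = fP x"
    using assms by (auto simp: strictly_monotonically_extendable_def monotone_extension_def)
  have mono: "f x \<le> f y" if "x \<le> y" for x y
    using that strict_monoD[OF f(1), of x y] by (auto simp: le_less)
  have "fP x \<le> f c" if "x \<in> P" "x \<le> c" for x c
    using that mono[of x c] f(2) by simp
  then show "upper_bounded_on_lower_sets P fP"
    unfolding upper_bounded_on_lower_sets_def lower_set_def bdd_above_def by blast
  have "f c \<le> fP x" if "x \<in> P" "c \<le> x" for x c
    using that mono[of c x] f(2) by simp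
  then show "lower_bounded_on_upper_sets P fP"
    unfolding lower_bounded_on_upper_sets_def upper_set_def bdd_below_def by blast
qed

lemma sup_below_upper: "y \<in> P \<Longrightarrow> y \<le> x \<Longrightarrow> ereal (fP y) \<le> sup_below P fP x"
  unfolding sup_below_def by (rule SUP_upper) simp

lemma inf_above_lower: "z \<in> P \<Longrightarrow> x \<le> z \<Longrightarrow> inf_above P fP x \<le> ereal (fP z)"
  unfolding inf_above_def by (rule INF_lower) simp

lemma sup_below_mono: "x \<le> y \<Longrightarrow> sup_below P fP x \<le> sup_below P fP y"
  unfolding sup_below_def by (rule SUP_subset_mono) auto

lemma inf_above_mono: "x \<le> y \<Longrightarrow> inf_above P fP x \<le> inf_above P fP y"
  unfolding inf_above_def by (rule INF_superset_mono) auto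

lemma sup_below_finite:
  assumes "upper_bounded_on_lower_sets P fP" "x \<in> region_U P"
  obtains r where "sup_below P fP x = ereal r"
proof -
  have "lower_set P {y \<in> P. y \<le> x}"
    by (auto simp: lower_set_def)
  then have "bdd_above (fP ` {y \<in> P. y \<le> x})"
    using assms(1) by (simp add: upper_bounded_on_lower_sets_def)
  then obtain M where "\<And>y. y \<in> P \<Longrightarrow> y \<le> x \<Longrightarrow> fP y \<le> M"
    by (auto simp: bdd_above_def)
  then have "sup_below P fP x \<le> ereal M"
    unfolding sup_below_def by (intro SUP_least) auto
  moreover obtain y where "y \<in> P" "y < x"
    using assms(2) by (auto simp: region_U_def)
  then have "ereal (fP y) \<le> sup_below P fP x"
    by (intro sup_below_upper) auto
  ultimately show thesis
    using that by (cases "sup_below P fP x") auto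
qed

lemma inf_above_finite:
  assumes "lower_bounded_on_upper_sets P fP" "x \<in> region_L P"
  obtains r where "inf_above P fP x = ereal r"
proof -
  have "upper_set P {z \<in> P. x \<le> z}"
    by (auto simp: upper_set_def)
  then have "bdd_below (fP ` {z \<in> P. x \<le> z})"
    using assms(1) by (simp add: lower_bounded_on_upper_sets_def)
  then obtain m where "\<And>z. z \<in> P \<Longrightarrow> x \<le> z \<Longrightarrow> m \<le> fP z"
    by (auto simp: bdd_below_def)
  then have "ereal m \<le> inf_above P fP x"
    unfolding inf_above_def by (intro INF_greatest) auto
  moreover obtain z where "z \<in> P" "x < z"
    using assms(2) by (auto simp: region_L_def)
  then have "inf_above P fP x \<le> ereal (fP z)"
    by (intro inf_above_lower) auto
  ultimately show thesis
    using that by (cases "inf_above P fP x") auto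
qed

text \<open>
  Being above a point of \<open>P\<close> is inherited upwards and being below one is inherited downwards. This
  excludes every pair of regions not listed here, such as \<open>x\<close> in \<open>U\<close> with \<open>y\<close> in \<open>P\<close>, which would put
  two comparable points into \<open>P\<close>.
\<close>

lemma less_region_cases:
  assumes "pareto_set P" "x < y"
  obtains (PU) "x \<in> P" "y \<in> region_U P"
    | (LP) "x \<in> region_L P" "y \<in> P"
    | (LL) "x \<in> region_L P" "y \<in> region_L P"
    | (UU) "x \<in> region_U P" "y \<in> region_U P"
    | (across) "x \<in> region_L P \<union> region_N P" "y \<in> region_U P \<union> region_N P"
proof -
  define A B where "A w \<longleftrightarrow> (\<exists>z\<in>P. w < z)" and "B w \<longleftrightarrow> (\<exists>y\<in>P. y < w)" for w
  have region: "w \<in> region_L P \<longleftrightarrow> w \<notin> P \<and> \<not> B w \<and> A w"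
    "w \<in> region_U P \<longleftrightarrow> w \<notin> P \<and> B w \<and> \<not> A w"
    "w \<in> region_N P \<longleftrightarrow> w \<notin> P \<and> \<not> B w \<and> \<not> A w" for w
    by (simp_all add: region_L_def region_U_def region_N_def A_def B_def)
  have cover: "w \<in> P \<or> w \<in> region_L P \<or> w \<in> region_U P \<or> w \<in> region_N P" for w
    using regions_cover[OF assms(1)] by blast
  have pareto: "w \<in> P \<Longrightarrow> \<not> B w \<and> \<not> A w" for w
    using assms(1) by (auto simp: pareto_set_def A_def B_def)
  have between: "x \<in> P \<Longrightarrow> B y" "y \<in> P \<Longrightarrow> A x"
    using assms(2) by (auto simp: A_def B_def)
  have inherit: "B x \<Longrightarrow> B y" "A y \<Longrightarrow> A x"
    using assms(2) less_trans by (auto simp: A_def B_def)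
  show thesis
    using that[unfolded Un_iff region] cover[of x, unfolded region] cover[of y, unfolded region]
      pareto[of x] pareto[of y] between inherit
    by argo
qed

lemma extension_formula_monotone_extension:
  assumes P: "pareto_set P"
    and bdd: "upper_bounded_on_lower_sets P fP" "lower_bounded_on_upper_sets P fP"
    and u: "strict_mono u" "\<And>x. \<alpha> < u x" "\<And>x. u x < \<beta>"
  shows "\<exists>f. (\<forall>x. ereal (f x) = extension_formula P fP \<alpha> \<beta> u x) \<and> monotone_extension P fP f"
proof -
  define a where "a x = real_of_ereal (sup_below P fP x)" for x
  define b where "b x = real_of_ereal (inf_above P fP x)" for x
  define f where "f x =
    (if x \<in> P then fP x
     else if x \<in> region_L P then min (b x) \<beta> - (\<beta> - u x)
     else if x \<in> region_U P then max (a x) \<alpha> + u x - \<alpha>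
     else u x)" for x
  have a: "sup_below P fP x = ereal (a x)" if "x \<in> region_U P" for x
    by (rule sup_below_finite[OF bdd(1) that]) (simp add: a_def)
  have b: "inf_above P fP x = ereal (b x)" if "x \<in> region_L P" for x
    by (rule inf_above_finite[OF bdd(2) that]) (simp add: b_def)
  have fP: "f x = fP x" if "x \<in> P" for x
    using that by (simp add: f_def)
  have fL: "f x = min (b x) \<beta> - (\<beta> - u x)" if "x \<in> region_L P" for x
    using that regions_disjoint[of P] by (auto simp: f_def)
  have fU: "f x = max (a x) \<alpha> + u x - \<alpha>" if "x \<in> region_U P" for x
    using that regions_disjoint[of P] by (auto simp: f_def)
  have fN: "f x = u x" if "x \<in> region_N P" for x
    using that regions_disjoint[of P] by (auto simp: f_def)
  have f_formula: "ereal (f x) = extension_formula P fP \<alpha> \<beta> u x" for x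
    by (auto simp: f_def extension_formula_def a b simp flip: ereal_min ereal_max)
  have "f x < f y" if "x < y" for x y
    using P that
  proof (cases rule: less_region_cases)
    case PU
    then have "fP x \<le> a y"
      using sup_below_upper[of x P y fP] a[of y] \<open>x < y\<close> by simp
    then show ?thesis
      using u(2)[of y] by (simp add: fP fU PU)
  next
    case LP
    then have "b x \<le> fP y"
      using inf_above_lower[of y P x fP] b[of x] \<open>x < y\<close> by simp
    then show ?thesis
      using u(3)[of x] by (simp add: fP fL LP)
  next
    case LL
    then have "b x \<le> b y"
      using inf_above_mono[of x y P fP] b \<open>x < y\<close> by simp
    then show ?thesis
      using strict_monoD[OF u(1) \<open>x < y\<close>] by (simp add: fL LL)
  next
    case UU
    then have "a x \<le> a y"
      using sup_below_mono[of x y P fP] a \<open>x < y\<close> by simp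
    then show ?thesis
      using strict_monoD[OF u(1) \<open>x < y\<close>] by (simp add: fU UU)
  next
    case across
    have "f x \<le> u x"
      using across(1) by (auto simp: fL fN)
    also have "u x < u y"
      using u(1) \<open>x < y\<close> by (rule strict_monoD)
    also have "u y \<le> f y"
      using across(2) by (auto simp: fU fN)
    finally show ?thesis .
  qed
  then have "monotone_extension P fP f"
    by (simp add: monotone_extension_def strict_mono_def fP)
  with f_formula show ?thesis
    by blast
qed

lemma strict_mono_arctan_sum: "strict_mono (\<lambda>x :: real ^ 'n. arctan (\<Sum>i\<in>UNIV. x $ i))"
proof (rule strict_monoI)
  fix x y :: "real ^ 'n"
  assume "x < y"
  then have "\<forall>i. x $ i \<le> y $ i" "\<exists>i. x $ i < y $ i"
    by (auto simp: vec_less_iff vec_eq_iff order_less_le)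
  then have "(\<Sum>i\<in>UNIV. x $ i) < (\<Sum>i\<in>UNIV. y $ i)"
    by (intro sum_strict_mono_ex1) auto
  then show "arctan (\<Sum>i\<in>UNIV. x $ i) < arctan (\<Sum>i\<in>UNIV. y $ i)"
    by (rule arctan_monotone)
qed

theorem corollary10:
  fixes P :: "(real ^ 'n) set" and fP :: "real ^ 'n \<Rightarrow> real"
  assumes "pareto_set P"
  shows "(strictly_monotonically_extendable P fP \<longleftrightarrow>
            upper_bounded_on_lower_sets P fP \<and> lower_bounded_on_upper_sets P fP) \<and>
         (upper_bounded_on_lower_sets P fP \<and> lower_bounded_on_upper_sets P fP \<longrightarrow>
            (\<forall>(\<alpha>::real) (\<beta>::real) (u :: real ^ 'n \<Rightarrow> real).
               strict_mono u \<and> (\<forall>x. \<alpha> < u x \<and> u x < \<beta>) \<longrightarrow>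
               (\<exists>f :: real ^ 'n \<Rightarrow> real.
                  (\<forall>x. ereal (f x) = extension_formula P fP \<alpha> \<beta> u x) \<and>
                  monotone_extension P fP f)))"
proof (intro conjI iffI impI allI)
  assume "strictly_monotonically_extendable P fP"
  then show "upper_bounded_on_lower_sets P fP" "lower_bounded_on_upper_sets P fP"
    by (rule bounded_if_strictly_monotonically_extendable)+
next
  assume bdd: "upper_bounded_on_lower_sets P fP \<and> lower_bounded_on_upper_sets P fP"
  show "strictly_monotonically_extendable P fP"
    using extension_formula_monotone_extension[OF assms conjunct1[OF bdd] conjunct2[OF bdd]
        strict_mono_arctan_sum, of "- (pi / 2)" "pi / 2"] arctan_lbound arctan_ubound
    by (auto simp: strictly_monotonically_extendable_def)
next
  fix \<alpha> \<beta> :: real and u :: "real ^ 'n \<Rightarrow> real"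
  assume "upper_bounded_on_lower_sets P fP \<and> lower_bounded_on_upper_sets P fP"
    and "strict_mono u \<and> (\<forall>x. \<alpha> < u x \<and> u x < \<beta>)"
  then show "\<exists>f. (\<forall>x. ereal (f x) = extension_formula P fP \<alpha> \<beta> u x) \<and> monotone_extension P fP f"
    using assms by (intro extension_formula_monotone_extension) auto
qed

end
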